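(* Let $x = (x_n) \in B_{c_0}$. For each integer $n \geq 3$ define $f_n: [-1,1] \to \mathbb{R}$ by $$f_n(t) = \begin{cases} 1+|t| &\text{ if } 0 \leq |t| \leq 1 - \frac{2}{n}, \\ (n-1)(1-|t|) &\text{ if } 1 - \frac{2}{n} \leq |t| \leq 1. \end{cases}$$ Then $$\delta c(x) \geq \min \{ f_n(x_{i_1}), \ldots, f_n(x_{i_n}) \}$$ for every $n \geq 3$ and every set of $n$ distinct indices $\{i_1, \ldots, i_n\} \subseteq \mathbb{N}$.
   Context: $c_0$ is the real Banach space of null sequences with the supremum norm. For a real Banach space $X$, $B_X$, $S_X$, $X^*$ denote the closed unit ball, unit sphere and topological dual. A slice of $B_X$ is a set $S(x^*,\delta)=\{y\in B_X : x^*(y)>1-\delta\}$ with $x^*\in S_{X^*}$ and $\delta>0$. For $x\in B_X$, the $\Delta$-constant $\delta c(x)$ is the supremum of all $\alpha\ge 0$ such that for all $\varepsilon,\delta>0$ and all $y^*\in S_{X^*}$ with $x\in S(y^*,\delta)$ there exists $y\in S(y^*,\delta)$ with $\|y-x\|>\alpha-\varepsilon$. *)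

theory Defs
  imports "HOL-Analysis.Analysis"
begin

section \<open>The Banach space of real null sequences\<close>

typedef c0 = "{x :: nat \<Rightarrow> real. x \<longlonglongrightarrow> 0}"
  morphisms c0_nth Abs_c0
  by (intro exI[of _ "\<lambda>_. 0"]) simp

setup_lifting type_definition_c0

lemma c0_eqI: "(\<And>n. c0_nth x n = c0_nth y n) \<Longrightarrow> x = y"
  by (metis c0_nth_inject ext)

lemma c0_nth_tendsto: "c0_nth x \<longlonglongrightarrow> 0"
  using c0_nth by simp

instantiation c0 :: real_vector
begin

lift_definition zero_c0 :: c0 is "\<lambda>_. 0" by simp
lift_definition plus_c0 :: "c0 \<Rightarrow> c0 \<Rightarrow> c0" is "\<lambda>x y n. x n + y n"
  by (rule tendsto_add_zero)
lift_definition uminus_c0 :: "c0 \<Rightarrow> c0" is "\<lambda>x n. - x n"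
  using tendsto_minus by fastforce
lift_definition minus_c0 :: "c0 \<Rightarrow> c0 \<Rightarrow> c0" is "\<lambda>x y n. x n - y n"
  using tendsto_diff by fastforce
lift_definition scaleR_c0 :: "real \<Rightarrow> c0 \<Rightarrow> c0" is "\<lambda>r x n. r * x n"
  by (rule tendsto_mult_right_zero)

instance
  by standard (transfer; simp add: algebra_simps fun_eq_iff)+

end

lemma c0_nth_simps [simp]:
  "c0_nth 0 n = 0"
  "c0_nth (x + y) n = c0_nth x n + c0_nth y n"
  "c0_nth (- x) n = - c0_nth x n"
  "c0_nth (x - y) n = c0_nth x n - c0_nth y n"
  "c0_nth (r *\<^sub>R x) n = r * c0_nth x n"
  by (transfer; simp)+

lemma bdd_above_c0: "bdd_above (range (\<lambda>n. \<bar>c0_nth x n\<bar>))"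
proof -
  have "Bseq (c0_nth x)"
    using c0_nth_tendsto convergentI convergent_imp_Bseq by blast
  then obtain K where "\<And>n. norm (c0_nth x n) \<le> K"
    unfolding Bseq_def by blast
  then show ?thesis
    by (auto intro!: bdd_aboveI)
qed

instantiation c0 :: real_normed_vector
begin

definition norm_c0 :: "c0 \<Rightarrow> real"
  where "norm x = (SUP n. \<bar>c0_nth x n\<bar>)"

definition sgn_c0 :: "c0 \<Rightarrow> c0"
  where "sgn (x::c0) = x /\<^sub>R norm x"

definition dist_c0 :: "c0 \<Rightarrow> c0 \<Rightarrow> real"
  where "dist (x::c0) y = norm (x - y)"

definition uniformity_c0 :: "(c0 \<times> c0) filter"
  where "uniformity_c0 = (INF e\<in>{0<..}. principal {(x::c0, y). dist x y < e})"

definition open_c0 :: "c0 set \<Rightarrow> bool"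
  where "open_c0 U = (\<forall>x\<in>U. eventually (\<lambda>(x', y). x' = x \<longrightarrow> y \<in> U) uniformity)"

instance
proof
  have nth_le: "\<bar>c0_nth x n\<bar> \<le> norm x" for x :: c0 and n
    unfolding norm_c0_def by (rule cSUP_upper[OF UNIV_I bdd_above_c0])
  have le_norm: "norm x \<le> K" if "\<And>n. \<bar>c0_nth x n\<bar> \<le> K" for x :: c0 and K
    unfolding norm_c0_def using that by (intro cSUP_least) auto
  fix x y :: c0 and a :: real
  show "(norm x = 0) = (x = 0)"
  proof
    assume "norm x = 0"
    then have "c0_nth x n = 0" for n
      using nth_le[of x n] by simp
    then show "x = 0"
      by (intro c0_eqI) simp
  qed (simp add: norm_c0_def)
  show "norm (x + y) \<le> norm x + norm y"
  proof (rule le_norm)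
    fix n
    show "\<bar>c0_nth (x + y) n\<bar> \<le> norm x + norm y"
      using nth_le[of x n] nth_le[of y n] by simp
  qed
  have scale_le: "norm (b *\<^sub>R z) \<le> \<bar>b\<bar> * norm z" for b and z :: c0
    by (rule le_norm) (simp add: abs_mult mult_left_mono nth_le)
  show "norm (a *\<^sub>R x) = \<bar>a\<bar> * norm x"
  proof (cases "a = 0")
    case True
    then show ?thesis
      by (simp add: norm_c0_def)
  next
    case False
    then have "norm x \<le> \<bar>inverse a\<bar> * norm (a *\<^sub>R x)"
      using scale_le[of "inverse a" "a *\<^sub>R x"] by simp
    then have "\<bar>a\<bar> * norm x \<le> norm (a *\<^sub>R x)"
      using False by (simp add: field_simps)
    then show ?thesis
      using scale_le[of a x] by simp
  qed
qed (fact sgn_c0_def dist_c0_def uniformity_c0_def open_c0_def)+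

end

lemma c0_nth_le_norm: "\<bar>c0_nth x n\<bar> \<le> norm x"
  unfolding norm_c0_def by (rule cSUP_upper[OF UNIV_I bdd_above_c0])

lemma norm_c0_le: "(\<And>n. \<bar>c0_nth x n\<bar> \<le> K) \<Longrightarrow> norm x \<le> K"
  unfolding norm_c0_def by (intro cSUP_least) auto

instance c0 :: banach
proof
  fix X :: "nat \<Rightarrow> c0"
  assume X: "Cauchy X"
  have "\<exists>l. (\<lambda>k. c0_nth (X k) n) \<longlonglongrightarrow> l" for n
  proof -
    have "Cauchy (\<lambda>k. c0_nth (X k) n)"
    proof (rule metric_CauchyI)
      fix e :: real
      assume "0 < e"
      then obtain M where M: "\<And>i j. i \<ge> M \<Longrightarrow> j \<ge> M \<Longrightarrow> dist (X i) (X j) < e"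
        using metric_CauchyD[OF X] by blast
      have "dist (c0_nth (X i) n) (c0_nth (X j) n) < e" if "i \<ge> M" "j \<ge> M" for i j
        using M[OF that] c0_nth_le_norm[of "X i - X j" n]
        by (simp add: dist_norm)
      then show "\<exists>M. \<forall>i\<ge>M. \<forall>j\<ge>M. dist (c0_nth (X i) n) (c0_nth (X j) n) < e"
        by blast
    qed
    then show ?thesis
      using Cauchy_convergent_iff convergent_def by blast
  qed
  then obtain g where g: "\<And>n. (\<lambda>k. c0_nth (X k) n) \<longlonglongrightarrow> g n"
    by metis
  have close: "\<exists>M. \<forall>i\<ge>M. \<forall>n. \<bar>c0_nth (X i) n - g n\<bar> \<le> e" if e: "0 < e" for e
  proof -
    obtain M where M: "\<And>i j. i \<ge> M \<Longrightarrow> j \<ge> M \<Longrightarrow> dist (X i) (X j) < e"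
      using metric_CauchyD[OF X e] by blast
    have "\<bar>c0_nth (X i) n - g n\<bar> \<le> e" if "i \<ge> M" for i n
    proof (rule LIMSEQ_le_const2)
      show "(\<lambda>j. \<bar>c0_nth (X i) n - c0_nth (X j) n\<bar>) \<longlonglongrightarrow> \<bar>c0_nth (X i) n - g n\<bar>"
        by (intro tendsto_intros g)
      have "\<bar>c0_nth (X i) n - c0_nth (X j) n\<bar> \<le> e" if "j \<ge> M" for j
        using M[OF \<open>i \<ge> M\<close> that] c0_nth_le_norm[of "X i - X j" n]
        by (simp add: dist_norm)
      then show "\<exists>N. \<forall>j\<ge>N. \<bar>c0_nth (X i) n - c0_nth (X j) n\<bar> \<le> e"
        by blast
    qed
    then show ?thesis
      by blast
  qed
  have "g \<longlonglongrightarrow> 0"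
  proof (rule LIMSEQ_I)
    fix e :: real
    assume "0 < e"
    then obtain i where i: "\<And>n. \<bar>c0_nth (X i) n - g n\<bar> \<le> e / 2"
      using close[of "e / 2"] by auto
    obtain N where N: "\<And>n. n \<ge> N \<Longrightarrow> \<bar>c0_nth (X i) n\<bar> < e / 2"
      using LIMSEQ_D[OF c0_nth_tendsto[of "X i"], of "e / 2"] \<open>0 < e\<close> by auto
    have "norm (g n - 0) < e" if "n \<ge> N" for n
      using i[of n] N[OF that] unfolding real_norm_def by linarith
    then show "\<exists>N. \<forall>n\<ge>N. norm (g n - 0) < e"
      by blast
  qed
  then have nth_g: "c0_nth (Abs_c0 g) = g"
    by (simp add: Abs_c0_inverse)
  have "X \<longlonglongrightarrow> Abs_c0 g"
  proof (rule LIMSEQ_I)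
    fix e :: real
    assume "0 < e"
    then obtain M where M: "\<And>i n. i \<ge> M \<Longrightarrow> \<bar>c0_nth (X i) n - g n\<bar> \<le> e / 2"
      using close[of "e / 2"] by auto
    have "norm (X i - Abs_c0 g) < e" if "i \<ge> M" for i
    proof -
      have "norm (X i - Abs_c0 g) \<le> e / 2"
        by (rule norm_c0_le) (use M[OF that] in \<open>simp add: nth_g\<close>)
      then show ?thesis
        using \<open>0 < e\<close> by simp
    qed
    then show "\<exists>M. \<forall>i\<ge>M. norm (X i - Abs_c0 g) < e"
      by blast
  qed
  then show "convergent X"
    by (rule convergentI)
qed


section \<open>Slices and the Delta-constant\<close>

text \<open>
  The dual of a Banach space \<open>'a\<close> is the type \<open>'a \<Rightarrow>\<^sub>L real\<close>, whose norm is the operator norm.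
  The closed unit ball and the unit sphere are \<open>cball 0 1\<close> and \<open>sphere 0 1\<close>.
\<close>

definition slice :: "('a::banach \<Rightarrow>\<^sub>L real) \<Rightarrow> real \<Rightarrow> 'a set"
  where "slice f \<delta> = {y \<in> cball 0 1. blinfun_apply f y > 1 - \<delta>}"

definition Delta_admissible :: "'a::banach \<Rightarrow> real set"
  where "Delta_admissible x = {\<alpha>. \<alpha> \<ge> 0 \<and>
    (\<forall>\<epsilon>>0. \<forall>\<delta>>0. \<forall>f \<in> sphere 0 1. x \<in> slice f \<delta> \<longrightarrow>
      (\<exists>y \<in> slice f \<delta>. norm (y - x) > \<alpha> - \<epsilon>))}"

text \<open>
  \<open>Delta_constant x\<close> is meant for \<open>x \<in> cball 0 1\<close> in a nonzero space. There the set of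
  admissible values contains \<open>0\<close> and is bounded above by \<open>2\<close>, so that the supremum, taken
  in the reals, is the true one; in the zero space the dual sphere is empty and the set
  is unbounded.
\<close>

definition Delta_constant :: "'a::banach \<Rightarrow> real"
  where "Delta_constant x = Sup (Delta_admissible x)"

lemma zero_in_Delta_admissible: "0 \<in> Delta_admissible x"
proof -
  have "norm (x - x) > 0 - \<epsilon>" if "\<epsilon> > 0" for \<epsilon> :: real
    using that by simp
  then show ?thesis
    unfolding Delta_admissible_def by blast
qed

lemma Delta_admissible_le_2:
  fixes x :: "'a::banach" and f :: "'a \<Rightarrow>\<^sub>L real"
  assumes "x \<in> cball 0 1" and f: "f \<in> sphere 0 1" and \<alpha>: "\<alpha> \<in> Delta_admissible x"
  shows "\<alpha> \<le> 2"
proof (rule field_le_epsilon)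
  fix e :: real
  assume "0 < e"
  have x: "norm x \<le> 1"
    using assms by simp
  have "norm (blinfun_apply f x) \<le> norm f * norm x"
    by (rule norm_blinfun)
  then have "x \<in> slice f 3"
    using x f by (auto simp: slice_def)
  moreover have "\<forall>\<delta>>0. x \<in> slice f \<delta> \<longrightarrow> (\<exists>y \<in> slice f \<delta>. norm (y - x) > \<alpha> - e)"
    using \<alpha> f \<open>0 < e\<close> unfolding Delta_admissible_def by blast
  ultimately obtain y where y: "y \<in> slice f 3" "norm (y - x) > \<alpha> - e"
    by (metis zero_less_numeral)
  then have "norm y \<le> 1"
    by (simp add: slice_def)
  then show "\<alpha> \<le> 2 + e"
    using y(2) x norm_triangle_ineq4[of y x] by linarith
qed


section \<open>The functions of the lower bound\<close>

text \<open>
  Only the values for \<open>n \<ge> 3\<close> and \<open>\<bar>t\<bar> \<le> 1\<close> matter. The two branches agree at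
  \<open>\<bar>t\<bar> = 1 - 2 / n\<close>.
\<close>

definition f_bound :: "nat \<Rightarrow> real \<Rightarrow> real"
  where "f_bound n t =
    (if \<bar>t\<bar> \<le> 1 - 2 / real n then 1 + \<bar>t\<bar> else (real n - 1) * (1 - \<bar>t\<bar>))"

end

(*
  Let m be the minimum and let f be a norm-one functional with f x > 1 - \<delta>, acting on the i-th
  unit vector as a i, with s i the sign of a i. If s i * x i \<le> 0 for some i in I, moving x i to
  s i does not decrease f and moves x by 1 + |x i|. Otherwise put u i = 1 - |x i|. Moving all
  x i to s i shows that the sum of |a i| * u i over I is below \<delta>. Taking an almost norming vector
  and replacing its i-th coordinate by x i - s i * m loses at most |a i| * (m + u i), so it suffices
  that this is below \<delta> for some i in I. The bounds defining f_bound give m \<le> (n - 1) * u i, i.e.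
  u i \<ge> (m + u i) / n, so if it failed for all n indices the sum would be at least \<delta>.
*)
theory Submission
  imports Defs
begin

lift_definition c0_unit :: "nat \<Rightarrow> c0" is "\<lambda>i k. if k = i then 1 else 0"
proof -
  fix i :: nat
  have "\<forall>\<^sub>F k in sequentially. (if k = i then 1 else 0 :: real) = 0"
    using eventually_gt_at_top[of i] by eventually_elim simp
  then show "(\<lambda>k. if k = i then 1 else 0 :: real) \<longlonglongrightarrow> 0"
    by (rule tendsto_eventually)
qed

lemma c0_nth_unit [simp]: "c0_nth (c0_unit i) k = (if k = i then 1 else 0)"
  by transfer simp

lemma c0_nth_sum [simp]: "c0_nth (\<Sum>i\<in>A. g i) k = (\<Sum>i\<in>A. c0_nth (g i) k)"
  by (induction A rule: infinite_finite_induct) auto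

lemma c0_nth_sum_units:
  assumes "finite A"
  shows "c0_nth (\<Sum>i\<in>A. r i *\<^sub>R c0_unit i) k = (if k \<in> A then r k else 0)"
proof -
  have "c0_nth (\<Sum>i\<in>A. r i *\<^sub>R c0_unit i) k = (\<Sum>i\<in>A. if k = i then r i else 0)"
    by (auto intro: sum.cong)
  then show ?thesis
    using assms by simp
qed

text \<open>The added sum overwrites the coordinates in \<open>A\<close> by \<open>v\<close> and
  leaves the others alone, so no coordinate exceeds 1 in modulus. All competitors for the slice are
  built this way.\<close>

lemma norm_c0_replace_le:
  assumes "finite A" "norm x \<le> 1" "\<And>i. i \<in> A \<Longrightarrow> \<bar>v i\<bar> \<le> 1"
  shows "norm (x + (\<Sum>i\<in>A. (v i - c0_nth x i) *\<^sub>R c0_unit i)) \<le> 1"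
proof (rule norm_c0_le)
  fix k
  show "\<bar>c0_nth (x + (\<Sum>i\<in>A. (v i - c0_nth x i) *\<^sub>R c0_unit i)) k\<bar> \<le> 1"
    using assms(2,3) c0_nth_le_norm[of x k]
    by (auto simp only: c0_nth_simps(2) c0_nth_sum_units[OF assms(1)])
       (auto intro: order_trans)
qed

lemma norm_c0_replace1_le:
  assumes "norm x \<le> 1" "\<bar>v\<bar> \<le> 1"
  shows "norm (x + (v - c0_nth x i) *\<^sub>R c0_unit i) \<le> 1"
  using norm_c0_replace_le[of "{i}" x "\<lambda>_. v"] assms by simp

lemma blinfun_almost_norming:
  fixes f :: "'a::real_normed_vector \<Rightarrow>\<^sub>L real"
  assumes "c < norm f"
  obtains z where "norm z \<le> 1" "c < blinfun_apply f z"
proof -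
  have "\<exists>z. norm z \<le> 1 \<and> c < blinfun_apply f z"
  proof (rule ccontr)
    assume "\<not> ?thesis"
    then have le: "blinfun_apply f z \<le> c" if "norm z \<le> 1" for z
      using that by force
    have "0 \<le> c"
      using le[of 0] by simp
    have "norm f \<le> c"
    proof (rule norm_blinfun_bound[OF \<open>0 \<le> c\<close>])
      fix x
      show "norm (blinfun_apply f x) \<le> c * norm x"
      proof (cases "x = 0")
        \<comment> \<open>Applying the bound to the normalised vector and to its negative controls
          the absolute value.\<close>
        case False
        then have "norm (x /\<^sub>R norm x) \<le> 1" "norm (- x /\<^sub>R norm x) \<le> 1"
          by simp_all
        from this[THEN le] False show ?thesis
          by (simp add: blinfun.scaleR_right blinfun.minus_right field_simps abs_le_iff)
      qed simp
    qed
    with assms show False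
      by simp
  qed
  with that show thesis
    by blast
qed

text \<open>Evaluation at coordinate 0 is a witness. Some norm-one functional is needed for
  \<open>Delta_admissible_le_2\<close>, hence for the supremum in \<open>Delta_constant\<close> to
  be a genuine one.\<close>

lemma c0_dual_sphere_nonempty: "\<exists>f :: c0 \<Rightarrow>\<^sub>L real. f \<in> sphere 0 1"
proof -
  have bl: "bounded_linear (\<lambda>x. c0_nth x 0)"
    by (rule bounded_linear_intro[where K = 1]) (auto simp: c0_nth_le_norm)
  let ?f = "Blinfun (\<lambda>x. c0_nth x 0)"
  have apply_f: "blinfun_apply ?f = (\<lambda>x. c0_nth x 0)"
    using bl by (rule bounded_linear_Blinfun_apply)
  have "norm ?f \<le> 1"
    by (rule norm_blinfun_bound) (auto simp: apply_f c0_nth_le_norm)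
  moreover have "1 \<le> norm ?f"
  proof -
    have "norm (c0_unit 0) \<le> 1"
      by (rule norm_c0_le) simp
    then have "norm ?f * norm (c0_unit 0) \<le> norm ?f"
      by (simp add: mult_left_le)
    moreover have "1 \<le> norm ?f * norm (c0_unit 0)"
      using norm_blinfun[of ?f "c0_unit 0"] by (simp add: apply_f)
    ultimately show ?thesis
      by linarith
  qed
  ultimately have "?f \<in> sphere 0 1"
    by simp
  then show ?thesis ..
qed

lemma bdd_above_Delta_admissible_c0:
  fixes x :: c0
  assumes "x \<in> cball 0 1"
  shows "bdd_above (Delta_admissible x)"
  using c0_dual_sphere_nonempty Delta_admissible_le_2[OF assms] by (meson bdd_aboveI)

lemma f_bound_nonneg:
  assumes "n \<ge> 3" "\<bar>t\<bar> \<le> 1"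
  shows "0 \<le> f_bound n t"
  using assms by (auto simp: f_bound_def)

text \<open>The threshold 1 - 2/n is exactly where the increasing and the decreasing branch cross,
  so \<open>f_bound\<close> is their minimum.\<close>

lemma f_bound_le:
  assumes "n \<ge> 3"
  shows f_bound_le_add: "f_bound n t \<le> 1 + \<bar>t\<bar>"
    and f_bound_le_mult: "f_bound n t \<le> (real n - 1) * (1 - \<bar>t\<bar>)"
proof -
  have n: "real n \<ge> 3"
    using assms by simp
  have iff: "\<bar>t\<bar> \<le> 1 - 2 / real n \<longleftrightarrow> 1 + \<bar>t\<bar> \<le> (real n - 1) * (1 - \<bar>t\<bar>)"
    using n by (simp add: field_simps)
  show "f_bound n t \<le> 1 + \<bar>t\<bar>" "f_bound n t \<le> (real n - 1) * (1 - \<bar>t\<bar>)"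
    using iff by (auto simp: f_bound_def)
qed

text \<open>Only the two upper bounds on \<open>m\<close> enter, one per branch of
  \<open>f_bound\<close>. The distance \<open>m\<close> is reached without an \<epsilon>;
  approximation occurs only in the value of \<open>f\<close>.\<close>

lemma slice_far_point:
  fixes x :: c0 and f :: "c0 \<Rightarrow>\<^sub>L real"
  assumes f: "norm f = 1" and x: "x \<in> slice f \<delta>"
    and I: "finite I" "card I = n" "n > 0"
    and m: "0 \<le> m" "\<And>i. i \<in> I \<Longrightarrow> m \<le> 1 + \<bar>c0_nth x i\<bar>"
      "\<And>i. i \<in> I \<Longrightarrow> m \<le> (real n - 1) * (1 - \<bar>c0_nth x i\<bar>)"
  shows "\<exists>y \<in> slice f \<delta>. m \<le> norm (y - x)"
proof -
  define a where "a i = blinfun_apply f (c0_unit i)" for i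
  \<comment> \<open>Unlike \<open>sgn\<close>, this is 1 at \<open>a i = 0\<close>, so that
    \<open>s i\<close> always has modulus 1 and a shift by \<open>s i * m\<close> has length exactly
    \<open>m\<close>.\<close>
  define s :: "nat \<Rightarrow> real" where "s i = (if a i \<ge> 0 then 1 else -1)" for i
  have s: "\<bar>s i\<bar> = 1" "s i * s i = 1" "a i * s i = \<bar>a i\<bar>" for i
    by (auto simp: s_def)
  have nx: "norm x \<le> 1" and fx: "1 - \<delta> < blinfun_apply f x"
    using x by (auto simp: slice_def)
  have f_add: "blinfun_apply f (z + r *\<^sub>R c0_unit i) = blinfun_apply f z + r * a i" for z r i
    by (simp add: blinfun.add_right blinfun.scaleR_right a_def)
  show ?thesis
  proof (cases "\<exists>i\<in>I. s i * c0_nth x i \<le> 0")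
    case True
    then obtain i where i: "i \<in> I" "s i * c0_nth x i \<le> 0"
      by blast
    define y where "y = x + (s i - c0_nth x i) *\<^sub>R c0_unit i"
    \<comment> \<open>Moving from \<open>c0_nth x i\<close> to \<open>s i\<close> passes through 0,
      so the lengths add up; the shift has the sign of \<open>a i\<close>, so \<open>f\<close> does
      not decrease.\<close>
    have dist: "\<bar>s i - c0_nth x i\<bar> = 1 + \<bar>c0_nth x i\<bar>"
      and "(s i - c0_nth x i) * a i \<ge> 0"
      using i(2) c0_nth_le_norm[of x i] nx
      by (auto simp: s_def mult_nonneg_nonneg mult_nonpos_nonpos split: if_splits)
    then have "y \<in> slice f \<delta>"
      using fx norm_c0_replace1_le[OF nx, of "s i" i] by (simp add: slice_def y_def f_add s)
    moreover have "m \<le> norm (y - x)"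
      using m(2)[OF i(1)] dist c0_nth_le_norm[of "y - x" i] by (simp add: y_def)
    ultimately show ?thesis
      by blast
  next
    case False
    define u where "u i = 1 - \<bar>c0_nth x i\<bar>" for i
    \<comment> \<open>Here \<open>c0_nth x i\<close> is nonzero with sign \<open>s i\<close> for all
      \<open>i\<close> in \<open>I\<close>.\<close>
    have sx: "s i * c0_nth x i = \<bar>c0_nth x i\<bar>" if "i \<in> I" for i
      using False that by (auto simp: s_def split: if_splits)
    have ax: "a i * c0_nth x i = \<bar>a i\<bar> * \<bar>c0_nth x i\<bar>" if "i \<in> I" for i
      using sx[OF that] s(3)[of i] s(2)[of i] by (metis mult.assoc mult.commute mult_1)
    have sum_lt: "(\<Sum>i\<in>I. \<bar>a i\<bar> * u i) < \<delta>"
    proof -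
      \<comment> \<open>Overwriting by the signs raises \<open>f\<close> by the sum in question, yet
        \<open>f\<close> stays at most 1 on the ball and already exceeds 1 - \<delta> at
        \<open>x\<close>.\<close>
      let ?z = "x + (\<Sum>i\<in>I. (s i - c0_nth x i) *\<^sub>R c0_unit i)"
      have "blinfun_apply f ?z \<le> norm f * norm ?z"
        using norm_blinfun[of f ?z] by simp
      also have "\<dots> \<le> 1"
        using norm_c0_replace_le[OF I(1) nx, of s] by (simp add: f s)
      finally have "blinfun_apply f ?z \<le> 1" .
      moreover have "blinfun_apply f ?z = blinfun_apply f x + (\<Sum>i\<in>I. (s i - c0_nth x i) * a i)"
        by (simp add: blinfun.add_right blinfun.sum_right blinfun.scaleR_right a_def)
      moreover have "(\<Sum>i\<in>I. (s i - c0_nth x i) * a i) = (\<Sum>i\<in>I. \<bar>a i\<bar> * u i)"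
        using s(3) ax by (intro sum.cong) (auto simp: u_def algebra_simps)
      ultimately show ?thesis
        using fx by linarith
    qed
    have "\<exists>i\<in>I. \<bar>a i\<bar> * (m + u i) < \<delta>"
    proof (rule ccontr)
      assume "\<not> ?thesis"
      then have ge: "\<delta> \<le> \<bar>a i\<bar> * (m + u i)" if "i \<in> I" for i
        using that by force
      have "\<delta> / real n \<le> \<bar>a i\<bar> * u i" if "i \<in> I" for i
      proof -
        \<comment> \<open>This is m \<le> (n - 1) * u i with u i added to both sides.\<close>
        have "\<bar>a i\<bar> * (m + u i) \<le> \<bar>a i\<bar> * (real n * u i)"
          using m(3)[OF that] by (intro mult_left_mono) (auto simp: u_def algebra_simps)
        with ge[OF that] show ?thesis
          using I(3) by (simp add: field_simps)
      qed
      then have "(\<Sum>i\<in>I. \<delta> / real n) \<le> (\<Sum>i\<in>I. \<bar>a i\<bar> * u i)"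
        by (rule sum_mono)
      then show False
        using sum_lt I by simp
    qed
    then obtain i where i: "i \<in> I" "\<bar>a i\<bar> * (m + u i) < \<delta>"
      by blast
    \<comment> \<open>The choice of \<open>i\<close> puts this threshold below 1 =
      \<open>norm f\<close>; the surplus over 1 - \<delta> pays for the replacement below.\<close>
    obtain z where z: "norm z \<le> 1" "1 - \<delta> + \<bar>a i\<bar> * (m + u i) < blinfun_apply f z"
      using blinfun_almost_norming[of "1 - \<delta> + \<bar>a i\<bar> * (m + u i)" f] i(2) f by auto
    \<comment> \<open>A step of length \<open>m\<close> from \<open>c0_nth x i\<close> towards 0 and
      possibly past it; m \<le> 1 + |x i| keeps it within [-1, 1].\<close>
    define v where "v = c0_nth x i - s i * m"
    define y where "y = z + (v - c0_nth z i) *\<^sub>R c0_unit i"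
    have v_le: "\<bar>v\<bar> \<le> 1"
    proof -
      have "v = s i * (\<bar>c0_nth x i\<bar> - m)"
        unfolding v_def sx[OF i(1), symmetric] by (simp add: algebra_simps s flip: mult.assoc)
      then have "\<bar>v\<bar> = \<bar>\<bar>c0_nth x i\<bar> - m\<bar>"
        by (simp add: abs_mult s)
      then show ?thesis
        using m(1) m(2)[OF i(1)] c0_nth_le_norm[of x i] nx by linarith
    qed
    have "a i * c0_nth z i \<le> \<bar>a i\<bar>"
    proof -
      have "\<bar>a i * c0_nth z i\<bar> \<le> \<bar>a i\<bar>"
        using c0_nth_le_norm[of z i] z(1) by (simp add: abs_mult mult_left_le)
      then show ?thesis
        by linarith
    qed
    moreover have "a i * v = \<bar>a i\<bar> * (\<bar>c0_nth x i\<bar> - m)"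
      using ax[OF i(1)] s(3)[of i] by (simp add: v_def right_diff_distrib flip: mult.assoc)
    \<comment> \<open>The old coordinate contributed at most |a i| to \<open>f\<close>, the new one
      gives |a i| * (|x i| - m); the difference is |a i| * (m + u i).\<close>
    ultimately have "(v - c0_nth z i) * a i \<ge> - (\<bar>a i\<bar> * (m + u i))"
      by (simp add: u_def algebra_simps)
    then have "y \<in> slice f \<delta>"
      using z norm_c0_replace1_le[OF z(1) v_le] by (simp add: slice_def y_def f_add)
    moreover have "m \<le> norm (y - x)"
      using m(1) c0_nth_le_norm[of "y - x" i] by (simp add: y_def v_def abs_mult s)
    ultimately show ?thesis
      by blast
  qed
qed

theorem theorem3p3:
  fixes x :: c0 and n :: nat and I :: "nat set"
  assumes "x \<in> cball 0 1"
    and "n \<ge> 3"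
    and "finite I" and "card I = n"
  shows "Delta_constant x \<ge> Min ((\<lambda>i. f_bound n (c0_nth x i)) ` I)"
proof -
  define m where "m = Min ((\<lambda>i. f_bound n (c0_nth x i)) ` I)"
  have "I \<noteq> {}"
    using assms by auto
  have m_le: "m \<le> f_bound n (c0_nth x i)" if "i \<in> I" for i
    using that assms(3) by (simp add: m_def)
  have "\<bar>c0_nth x i\<bar> \<le> 1" for i
    using assms(1) c0_nth_le_norm[of x i] by simp
  then have "0 \<le> m"
    using assms \<open>I \<noteq> {}\<close> by (simp add: m_def f_bound_nonneg)
  moreover have "\<exists>y \<in> slice f \<delta>. m \<le> norm (y - x)"
    if "\<delta> > 0" "f \<in> sphere 0 1" "x \<in> slice f \<delta>" for \<delta> f
    using that assms \<open>0 \<le> m\<close> m_le f_bound_le[OF assms(2)]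
    by (intro slice_far_point[of f x \<delta> I n m]) (auto intro: order_trans)
  ultimately have "m \<in> Delta_admissible x"
    unfolding Delta_admissible_def by (smt (verit) mem_Collect_eq)
  then show ?thesis
    unfolding Delta_constant_def m_def[symmetric]
    by (rule cSup_upper[OF _ bdd_above_Delta_admissible_c0[OF assms(1)]])
qed

end
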